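(* Consider a two-asset AMM, given by swap primitives $X,Y:\mathbb R^2\times[0,\infty)\to\mathbb R^2$, satisfying validity invariance, Pareto efficiency, and unit invariance. Then there exists $w\in(0,1)$ such that the trading orbits in $\mathcal S$ are exactly the level sets in $\mathcal S$ of $\Phi(x,y):=x^w y^{1-w}$; that is, for all $s,t\in\mathcal S$, $s\sim t$ if and only if $\Phi(s)=\Phi(t)$.
   Context: A state is a pair $s=(x,y)\in\mathbb R^2$; the valid state space is $\mathcal S=\{(x,y)\in\mathbb R^2: x>0,\ y>0\}$. A two-asset AMM consists of two swap primitives $X,Y:\mathbb R^2\times[0,\infty)\to\mathbb R^2$ of the form $X((x,y),dx)=(x+dx,\;y-y_{\mathrm{out}}((x,y),dx))$ and $Y((x,y),dy)=(x-x_{\mathrm{out}}((x,y),dy),\;y+dy)$, where $x_{\mathrm{out}},y_{\mathrm{out}}:\mathbb R^2\times[0,\infty)\to\mathbb R$ are arbitrary functions. Adjacency: $s\leftrightarrow t$ if there is $\delta\ge 0$ with $t=X(s,\delta)$ or $t=Y(s,\delta)$ or $s=X(t,\delta)$ or $s=Y(t,\delta)$. Orbit relation: $s\sim t$ if there is a finite chain of states (in $\mathbb R^2$) $s=s_0,s_1,\dots,s_n=t$ ($n\ge 0$) with $s_{i-1}\leftrightarrow s_i$ for all $i$. The trading orbit of $s\in\mathcal S$ is $[s]=\{t\in\mathcal S: t\sim s\}$. Validity invariance: for every $s\in\mathbb R^2$ and all $dx,dy\ge0$, $X(s,dx)\in\mathcal S\iff s\in\mathcal S$ and $Y(s,dy)\in\mathcal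 S\iff s\in\mathcal S$. Pareto efficiency: write $t\succeq s$ if both coordinates of $t$ are $\ge$ those of $s$. For all $s,t\in\mathcal S$, if $s\sim t$ and $t\succeq s$, then $t=s$. Unit invariance: with $T_{a,b}(x,y)=(ax,by)$, for all $a,b>0$, $s\in\mathcal S$, $dx,dy\ge0$: $X(T_{a,b}s,a\,dx)=T_{a,b}X(s,dx)$ and $Y(T_{a,b}s,b\,dy)=T_{a,b}Y(s,dy)$. *)

theory Defs
  imports Complex_Main
begin

type_synonym state = "real \<times> real"

(* The trade size lives in [0, \<infinity>): HOL functions are total, so the second argument is a real and
   every condition below only constrains (or uses) nonnegative trade sizes. *)
type_synonym swap = "state \<Rightarrow> real \<Rightarrow> state"

definition valid_states :: "state set" where
  "valid_states = {(x, y). x > 0 \<and> y > 0}"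

definition two_asset_amm :: "swap \<Rightarrow> swap \<Rightarrow> bool" where
  "two_asset_amm X Y \<longleftrightarrow>
     (\<exists>y_out :: state \<Rightarrow> real \<Rightarrow> real. \<forall>x y. \<forall>dx\<ge>0. X (x, y) dx = (x + dx, y - y_out (x, y) dx)) \<and>
     (\<exists>x_out :: state \<Rightarrow> real \<Rightarrow> real. \<forall>x y. \<forall>dy\<ge>0. Y (x, y) dy = (x - x_out (x, y) dy, y + dy))"

definition adjacent :: "swap \<Rightarrow> swap \<Rightarrow> state \<Rightarrow> state \<Rightarrow> bool" where
  "adjacent X Y s t \<longleftrightarrow>
     (\<exists>\<delta>\<ge>0. t = X s \<delta> \<or> t = Y s \<delta> \<or> s = X t \<delta> \<or> s = Y t \<delta>)"

(* Intermediate states of a chain range over the whole plane, not only over the valid states. *)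
definition orbit_rel :: "swap \<Rightarrow> swap \<Rightarrow> state \<Rightarrow> state \<Rightarrow> bool" where
  "orbit_rel X Y = rtranclp (adjacent X Y)"

definition trading_orbit :: "swap \<Rightarrow> swap \<Rightarrow> state \<Rightarrow> state set" where
  "trading_orbit X Y s = {t \<in> valid_states. orbit_rel X Y t s}"

definition validity_invariant :: "swap \<Rightarrow> swap \<Rightarrow> bool" where
  "validity_invariant X Y \<longleftrightarrow>
     (\<forall>s. \<forall>dx\<ge>0. X s dx \<in> valid_states \<longleftrightarrow> s \<in> valid_states) \<and>
     (\<forall>s. \<forall>dy\<ge>0. Y s dy \<in> valid_states \<longleftrightarrow> s \<in> valid_states)"

definition weakly_dominates :: "state \<Rightarrow> state \<Rightarrow> bool" where
  "weakly_dominates t s \<longleftrightarrow> fst t \<ge> fst s \<and> snd t \<ge> snd s"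

definition pareto_efficient :: "swap \<Rightarrow> swap \<Rightarrow> bool" where
  "pareto_efficient X Y \<longleftrightarrow>
     (\<forall>s\<in>valid_states. \<forall>t\<in>valid_states.
        orbit_rel X Y s t \<and> weakly_dominates t s \<longrightarrow> t = s)"

definition rescale :: "real \<Rightarrow> real \<Rightarrow> state \<Rightarrow> state" where
  "rescale a b s = (a * fst s, b * snd s)"

definition unit_invariant :: "swap \<Rightarrow> swap \<Rightarrow> bool" where
  "unit_invariant X Y \<longleftrightarrow>
     (\<forall>a>0. \<forall>b>0. \<forall>s\<in>valid_states.
        (\<forall>dx\<ge>0. X (rescale a b s) (a * dx) = rescale a b (X s dx)) \<and>
        (\<forall>dy\<ge>0. Y (rescale a b s) (b * dy) = rescale a b (Y s dy)))"

definition geometric_mean_potential :: "real \<Rightarrow> state \<Rightarrow> real" where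
  "geometric_mean_potential w s = fst s powr w * snd s powr (1 - w)"

end

theory Submission
  imports Defs
begin

text \<open>Validity and unit invariance make the orbit relation on valid states invariant under the
  scalings, so in logarithmic coordinates the orbit of \<open>(1, 1)\<close> is an additive subgroup of the plane
  and the other orbits are its cosets. The primitive \<open>X\<close> makes this subgroup project onto the first
  axis, and Pareto efficiency makes it the graph of a decreasing function. A monotone additive
  function is linear, so the subgroup is a line \<open>v = -c u\<close> with \<open>c > 0\<close>, which yields
  \<open>w = c / (1 + c)\<close>.\<close>

text \<open>Squeezing \<open>n * x\<close> between consecutive integers, where additivity alone
  fixes the values of \<open>g\<close>, bounds \<open>n\<close> times the error by
  \<open>g 1\<close> for every \<open>n\<close>; by the Archimedean property the error is
  zero.\<close>

lemma additive_mono_real_linear: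
  fixes g :: "real \<Rightarrow> real"
  assumes "additive g" and "mono g"
  shows "g x = x * g 1"
proof -
  interpret additive g by fact
  have nat_mult: "g (real n * y) = real n * g y" for n y
    by (induction n) (simp_all add: zero add algebra_simps)
  have int_mult: "g (of_int k) = of_int k * g 1" for k :: int
    by (cases k rule: int_cases2) (use nat_mult[of _ 1] in \<open>simp_all add: minus\<close>)
  have "real n * \<bar>g x - x * g 1\<bar> \<le> g 1" for n
  proof -
    define m where "m = \<lfloor>real n * x\<rfloor>"
    have m: "of_int m \<le> real n * x" "real n * x \<le> of_int (m + 1)"
      unfolding m_def by linarith+
    have lo: "of_int m * g 1 \<le> real n * g x"
      using monoD[OF \<open>mono g\<close> m(1)] by (simp only: nat_mult int_mult)
    have hi: "real n * g x \<le> of_int (m + 1) * g 1"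
      using monoD[OF \<open>mono g\<close> m(2)] by (simp only: nat_mult int_mult)
    have "0 \<le> g 1"
      using monoD[OF \<open>mono g\<close>, of 0 1] by (simp add: zero)
    then have "of_int m * g 1 \<le> real n * x * g 1" "real n * x * g 1 \<le> of_int (m + 1) * g 1"
      using m by (auto intro: mult_right_mono)
    then have "\<bar>real n * (g x - x * g 1)\<bar> \<le> g 1"
      using lo hi by (simp add: algebra_simps abs_le_iff)
    then show ?thesis by (simp add: abs_mult)
  qed
  then have "\<not> 0 < \<bar>g x - x * g 1\<bar>"
    using reals_Archimedean3[of "\<bar>g x - x * g 1\<bar>"] by (meson not_le)
  then show ?thesis by simp
qed

lemma plane_subgroup_is_line:
  fixes Q :: "real \<Rightarrow> real \<Rightarrow> bool"
  assumes add: "\<And>u v u' v'. Q u v \<Longrightarrow> Q u' v' \<Longrightarrow> Q (u + u') (v + v')"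
    and minus: "\<And>u v. Q u v \<Longrightarrow> Q (- u) (- v)"
    and total: "\<And>u. 0 \<le> u \<Longrightarrow> \<exists>v. Q u v"
    and pareto: "\<And>u v. Q u v \<Longrightarrow> 0 \<le> u \<Longrightarrow> 0 \<le> v \<Longrightarrow> u = 0 \<and> v = 0"
  shows "\<exists>c>0. \<forall>u v. Q u v \<longleftrightarrow> v = - c * u"
proof -
  have "\<exists>v. Q u v" for u
  proof (cases "0 \<le> u")
    case False
    then obtain v where "Q (- u) v" using total[of "- u"] by auto
    then show ?thesis using minus[of "- u" v] by auto
  qed (rule total)
  then obtain f where f: "\<And>u. Q u (f u)" by metis
  have unique: "v = v'" if "Q u v" "Q u v'" for u v v'
  proof -
    \<comment> \<open>One of these two opposite vertical vectors is nonnegative, so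
      \<open>pareto\<close> forces it to vanish.\<close>
    have "Q 0 (v - v')" "Q 0 (v' - v)"
      using add[OF that(1) minus[OF that(2)]] add[OF that(2) minus[OF that(1)]] by simp_all
    then show ?thesis
      using pareto[of 0 "v - v'"] pareto[of 0 "v' - v"] by linarith
  qed
  have f_add: "f (u + u') = f u + f u'" for u u'
    using unique[OF f add[OF f f]] .
  interpret f: additive f by (unfold_locales) (rule f_add)
  have f_neg: "f u \<le> 0" if "0 \<le> u" for u
    using pareto[OF f[of u]] that by force
  \<comment> \<open>Additivity reduces monotonicity to the sign of \<open>f\<close> at the
    nonnegative increment \<open>u' - u\<close>.\<close>
  have "- f u \<le> - f u'" if "u \<le> u'" for u u'
    using f_neg[of "u' - u"] f.diff[of u' u] that by simp
  then have "mono (\<lambda>u. - f u)"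
    by (rule monoI)
  moreover have "additive (\<lambda>u. - f u)"
    by unfold_locales (simp add: f_add)
  ultimately have lin: "- f u = u * (- f 1)" for u
    using additive_mono_real_linear by blast
  show ?thesis
  proof (intro exI conjI allI)
    \<comment> \<open>If \<open>f 1\<close> were nonnegative, \<open>pareto\<close> would apply to
      the point \<open>(1, f 1)\<close> and give \<open>1 = 0\<close>.\<close>
    show "0 < - f 1"
      using pareto[OF f[of 1]] by force
    show "Q u v \<longleftrightarrow> v = - (- f 1) * u" for u v
    proof -
      have "- (- f 1) * u = f u"
        using arg_cong[OF lin[of u], of uminus] by (simp only: minus_minus mult_minus_right mult.commute)
      then show ?thesis
        using unique f by metis
    qed
  qed
qed

lemma orbit_rel_sym: "orbit_rel X Y s t \<Longrightarrow> orbit_rel X Y t s"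
  unfolding orbit_rel_def
  by (rule sympD[OF symp_rtranclp]) (auto simp: symp_def adjacent_def)

lemma orbit_rel_trans: "orbit_rel X Y s t \<Longrightarrow> orbit_rel X Y t r \<Longrightarrow> orbit_rel X Y s r"
  unfolding orbit_rel_def by (rule rtranclp_trans)

lemma adjacent_valid:
  assumes "validity_invariant X Y" "adjacent X Y s t" "s \<in> valid_states"
  shows "t \<in> valid_states"
  using assms unfolding validity_invariant_def adjacent_def by metis

text \<open>Unit invariance is available only at valid states, and the swap may start at either end,
  so both ends must be valid. Trade sizes scale by \<open>a\<close> for \<open>X\<close> and by
  \<open>b\<close> for \<open>Y\<close>.\<close>

lemma adjacent_rescale:
  assumes "validity_invariant X Y" "unit_invariant X Y" "0 < a" "0 < b"
    and st: "adjacent X Y s t" "s \<in> valid_states"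
  shows "adjacent X Y (rescale a b s) (rescale a b t)"
proof -
  have t: "t \<in> valid_states" by (rule adjacent_valid) fact+
  obtain d where d: "0 \<le> d" "t = X s d \<or> t = Y s d \<or> s = X t d \<or> s = Y t d"
    using st unfolding adjacent_def by blast
  have X: "X (rescale a b r) (a * d) = rescale a b (X r d)"
    and Y: "Y (rescale a b r) (b * d) = rescale a b (Y r d)" if "r \<in> valid_states" for r
    using assms(2-4) d(1) that unfolding unit_invariant_def by auto
  have "0 \<le> a * d" "0 \<le> b * d"
    using assms(3,4) d(1) by auto
  then show ?thesis
    using d(2) X Y st(2) t unfolding adjacent_def by metis
qed

text \<open>A chain may a priori leave the valid states; the induction therefore carries validity
  along from \<open>s\<close>, so that each link can be rescaled.\<close>

lemma orbit_rel_rescale: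
  assumes "validity_invariant X Y" "unit_invariant X Y" "0 < a" "0 < b"
    and "orbit_rel X Y s t" "s \<in> valid_states"
  shows "orbit_rel X Y (rescale a b s) (rescale a b t)"
proof -
  have "rtranclp (adjacent X Y) s t"
    using assms(5) unfolding orbit_rel_def .
  then have "t \<in> valid_states \<and> orbit_rel X Y (rescale a b s) (rescale a b t)"
  proof induction
    case base
    then show ?case by (simp add: orbit_rel_def assms(6))
  next
    case (step t r)
    then have "adjacent X Y (rescale a b t) (rescale a b r)"
      using adjacent_rescale assms(1-4) by blast
    then show ?case
      using step adjacent_valid[OF assms(1)] unfolding orbit_rel_def
      by (metis rtranclp.rtrancl_into_rtrancl)
  qed
  then show ?thesis by blast
qed

theorem theorem2p9:
  fixes X Y :: swap
  assumes "two_asset_amm X Y"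
    and "validity_invariant X Y"
    and "pareto_efficient X Y"
    and "unit_invariant X Y"
  shows "\<exists>w. 0 < w \<and> w < 1 \<and>
    (\<forall>s\<in>valid_states. trading_orbit X Y s =
       {t \<in> valid_states. geometric_mean_potential w t = geometric_mean_potential w s}) \<and>
    (\<forall>s\<in>valid_states. \<forall>t\<in>valid_states.
       orbit_rel X Y s t \<longleftrightarrow> geometric_mean_potential w s = geometric_mean_potential w t)"
proof -
  define Q where "Q u v = orbit_rel X Y (1, 1) (exp u, exp v)" for u v
  have valid_exp: "(exp u, exp v) \<in> valid_states" for u v :: real
    by (simp add: valid_states_def)
  have valid_one: "(1, 1) \<in> valid_states"
    by (simp add: valid_states_def)
  have shift: "orbit_rel X Y (exp (p + u), exp (q + v)) (exp (p + u'), exp (q + v'))"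
    if "orbit_rel X Y (exp u, exp v) (exp u', exp v')" for p q u v u' v'
    using orbit_rel_rescale[OF assms(2,4) _ _ that valid_exp, of "exp p" "exp q"]
    by (simp add: rescale_def exp_add)
  have Q_iff: "orbit_rel X Y (exp u, exp v) (exp u', exp v') \<longleftrightarrow> Q (u' - u) (v' - v)" for u v u' v'
    \<comment> \<open>Translating by \<open>(-u, -v)\<close> brings the first state to
      \<open>(1, 1)\<close>; translating by \<open>(u, v)\<close> undoes this.\<close>
    using shift[of u v u' v' "- u" "- v"] shift[of 0 0 "u' - u" "v' - v" u v]
    by (auto simp: Q_def)
  have "\<exists>c>0. \<forall>u v. Q u v \<longleftrightarrow> v = - c * u"
  proof (rule plane_subgroup_is_line[of Q])
    show "Q (u + u') (v + v')" if "Q u v" "Q u' v'" for u v u' v'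
      using Q_iff[of u v "u + u'" "v + v'"] that orbit_rel_trans unfolding Q_def by fastforce
    show "Q (- u) (- v)" if "Q u v" for u v
      using Q_iff[of u v 0 0] orbit_rel_sym that unfolding Q_def by fastforce
    show "\<exists>v. Q u v" if "0 \<le> u" for u
    proof -
      \<comment> \<open>An \<open>X\<close> trade of this size takes the first coordinate from 1 to
        \<open>exp u\<close>; validity makes the second one positive, so its logarithm can serve as
        \<open>v\<close>.\<close>
      have d: "0 \<le> exp u - 1" using that by simp
      obtain y where y: "X (1, 1) (exp u - 1) = (exp u, y)"
        using assms(1) d unfolding two_asset_amm_def by force
      have "(exp u, y) \<in> valid_states"
        using assms(2) d valid_one unfolding validity_invariant_def by (metis y)
      then have "exp (ln y) = y"
        by (simp add: valid_states_def)
      moreover have "adjacent X Y (1, 1) (exp u, y)"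
        using y d unfolding adjacent_def by metis
      ultimately have "Q u (ln y)"
        by (simp add: Q_def orbit_rel_def r_into_rtranclp)
      then show ?thesis ..
    qed
    show "u = 0 \<and> v = 0" if "Q u v" "0 \<le> u" "0 \<le> v" for u v
    proof -
      have "(exp u, exp v) = (1, 1)"
        using assms(3)[unfolded pareto_efficient_def, rule_format, OF valid_one valid_exp] that
        by (simp add: weakly_dominates_def Q_def)
      then show ?thesis by simp
    qed
  qed
  then obtain c where c: "0 < c" and line: "\<And>u v. Q u v \<longleftrightarrow> v = - c * u"
    by blast
  \<comment> \<open>Chosen so that \<open>w / (1 - w) = c\<close>: the lines on which
    \<open>w * u + (1 - w) * v\<close> is constant then have slope \<open>-c\<close>.\<close>
  define w where "w = c / (1 + c)"
  have w: "0 < w" "w < 1" "1 - w = 1 / (1 + c)"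
    using c by (simp_all add: w_def field_simps)
  have main: "orbit_rel X Y s t \<longleftrightarrow> geometric_mean_potential w s = geometric_mean_potential w t"
    if valid: "s \<in> valid_states" "t \<in> valid_states" for s t
  proof -
    obtain x y x' y' where st: "s = (x, y)" "t = (x', y')" "0 < x" "0 < y" "0 < x'" "0 < y'"
      using valid by (auto simp: valid_states_def)
    have "orbit_rel X Y s t \<longleftrightarrow> ln y' - ln y = - c * (ln x' - ln x)"
      using Q_iff[of "ln x" "ln y" "ln x'" "ln y'"] st by (simp add: line)
    also have "\<dots> \<longleftrightarrow> w * ln x + (1 - w) * ln y = w * ln x' + (1 - w) * ln y'"
    proof -
      have combine: "w * p + (1 - w) * q = (c * p + q) / (1 + c)" for p q
        unfolding w(3) by (simp add: w_def add_divide_distrib)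
      show ?thesis
        unfolding combine using c by (auto simp: algebra_simps)
    qed
    also have "\<dots> \<longleftrightarrow> geometric_mean_potential w s = geometric_mean_potential w t"
      \<comment> \<open>The potential is the exponential of this weighted sum of logarithms, and
        \<open>exp\<close> is injective.\<close>
      using st by (simp add: geometric_mean_potential_def powr_def flip: exp_add)
    finally show ?thesis .
  qed
  show ?thesis
    using w main by (intro exI[of _ w]) (auto simp: trading_orbit_def)
qed

end
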